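(* Let $q$ be a positive integer, let $S$ be a numerical semigroup, let $n\in S\setminus\{0\}$, and for $0\leq i\leq n-1$ let $w(i)$ be the least element of $S$ congruent to $i$ modulo $n$ (so $w(0)=0$ and $\mathrm{Ap}(S,n)=\{w(0),w(1),\dots,w(n-1)\}$). Then $S=\langle n,w(1),\dots,w(n-1)\rangle$, and, writing $k_i:=(k-iq)\bmod n$, $$GM_q(S)=1+\frac1n\sum_{k=0}^{n-1}\min_{1\leq i\leq n-1}\left\{qn,\ qw(i)-w(k)+w(k_i)\right\},$$ where for each $k$ the minimum is taken over the set consisting of $qn$ together with the numbers $qw(i)-w(k)+w(k_i)$ for $1\leq i\leq n-1$.
   Context: A numerical semigroup is an additive submonoid $S\subseteq\mathbb N$ with finite complement. The Apéry set of a nonzero $n\in S$ is $\mathrm{Ap}(S,n)=\{s\in S: s-n\notin S\}$. For integers $a$ and $b\geq 1$, $a\bmod b$ denotes the remainder in $\{0,\dots,b-1\}$. Write $S^*=S\setminus\{0\}$, $qS^*+S=\{qa+b: a\in S^*,\ b\in S\}$, and $GM_q(S):=\#\big(S\setminus (qS^*+S)\big)+1$. *)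

theory Defs
  imports Complex_Main "HOL-Number_Theory.Cong"
begin

definition add_submonoid :: "nat set \<Rightarrow> bool" where
  "add_submonoid S \<longleftrightarrow> 0 \<in> S \<and> (\<forall>a\<in>S. \<forall>b\<in>S. a + b \<in> S)"

definition numerical_semigroup :: "nat set \<Rightarrow> bool" where
  "numerical_semigroup S \<longleftrightarrow> add_submonoid S \<and> finite (- S)"

definition generated :: "nat set \<Rightarrow> nat set" where
  "generated X = add_submonoid hull X"

text \<open>The difference \<open>s - n\<close> is taken in the integers; truncated subtraction on the
  naturals would wrongly exclude the elements of \<open>S\<close> below \<open>n\<close>.\<close>

definition Ap :: "nat set \<Rightarrow> nat \<Rightarrow> nat set" where
  "Ap S n = {s \<in> S. int s - int n \<notin> int ` S}"

definition GM :: "nat \<Rightarrow> nat set \<Rightarrow> nat" where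
  "GM q S = card (S - {q * a + b | a b. a \<in> S - {0} \<and> b \<in> S}) + 1"

end

theory Submission
  imports Defs
begin

text \<open>Sort the elements of \<open>S\<close> and of \<open>T = q S\<^sup>* + S\<close> by their residue \<open>k\<close> modulo \<open>n\<close>. Both sets are
  closed under adding \<open>n\<close>, so in each class they are the final segments starting at their least
  elements \<open>w k\<close> and \<open>m k\<close>, and \<open>S - T\<close> has \<open>(m k - w k) / n\<close> elements there. Writing an element of
  \<open>T\<close> in the class \<open>k\<close> as \<open>q a + b\<close> with \<open>a\<close> in the class \<open>i\<close>, minimality of \<open>w\<close> shows that \<open>m k\<close> is the
  minimum of \<open>q n + w k\<close> (attained for \<open>i = 0\<close>, where \<open>a \<noteq> 0\<close> forces \<open>a \<ge> n\<close>) and of the numbers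
  \<open>q w i + w (k - i q)\<close> with \<open>i \<noteq> 0\<close>.\<close>

section \<open>Residue classes modulo \<open>n\<close> and their least elements\<close>

definition class_min :: "nat set \<Rightarrow> nat \<Rightarrow> nat \<Rightarrow> nat" where
  "class_min A n k = (LEAST s. s \<in> A \<and> [s = k] (mod n))"

lemma class_min_le:
  assumes "s \<in> A" "[s = k] (mod n)"
  shows "class_min A n k \<le> s"
  unfolding class_min_def using assms by (intro Least_le) simp

lemma class_min_mem:
  assumes "\<exists>s\<in>A. [s = k] (mod n)"
  shows "class_min A n k \<in> A" "[class_min A n k = k] (mod n)"
  unfolding class_min_def
  using LeastI_ex[of "\<lambda>s. s \<in> A \<and> [s = k] (mod n)"] assms by auto

lemma add_mult_mem:
  fixes A :: "nat set"
  assumes "\<And>s. s \<in> A \<Longrightarrow> s + n \<in> A" "s \<in> A"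
  shows "s + n * j \<in> A"
proof (induction j)
  case (Suc j)
  then show ?case using assms(1)[of "s + n * j"] by (simp add: algebra_simps)
qed (use assms in simp)

lemma cong_le_imp_add_mult:
  fixes a b n :: nat
  assumes "a \<le> b" "[a = b] (mod n)"
  obtains j where "b = a + n * j"
proof -
  have "n dvd b - a" using assms mod_eq_dvd_iff_nat[of a b n] by (simp add: cong_def)
  then obtain j where "b - a = n * j" by (rule dvdE)
  then show ?thesis using assms(1) that[of j] by simp
qed

text \<open>A member of the class above the least one exceeds it by a multiple of \<open>n\<close>,
  hence stays in \<open>A\<close>. Membership in \<open>S\<close> and in \<open>T\<close> thus
  becomes an inequality, which is what counting \<open>S - T\<close> needs.\<close>

lemma mem_class_iff:
  assumes "\<And>s. s \<in> A \<Longrightarrow> s + n \<in> A"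
    and "\<exists>s\<in>A. [s = k] (mod n)" "[x = k] (mod n)"
  shows "x \<in> A \<longleftrightarrow> class_min A n k \<le> x"
proof
  show "class_min A n k \<le> x" if "x \<in> A" using that assms(3) by (rule class_min_le)
next
  assume "class_min A n k \<le> x"
  moreover have "[class_min A n k = x] (mod n)"
    using class_min_mem(2)[OF assms(2)] assms(3) by (simp add: cong_def)
  ultimately obtain j where "x = class_min A n k + n * j"
    by (rule cong_le_imp_add_mult)
  then show "x \<in> A" using add_mult_mem[OF assms(1) class_min_mem(1)[OF assms(2)]] by simp
qed

text \<open>Writing \<open>x = a + n * i\<close> and \<open>b = a + n * j\<close> identifies the set
  with the indices \<open>i < j\<close>. The factor \<open>n\<close> on the left avoids division of
  naturals; it turns into \<open>1 / real n\<close> only in the theorem.\<close>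

lemma card_residue_interval:
  fixes a b k n :: nat
  assumes "n > 0" "[a = k] (mod n)" "[b = k] (mod n)" "a \<le> b"
  shows "n * card {x. [x = k] (mod n) \<and> a \<le> x \<and> x < b} = b - a"
proof -
  have "[a = b] (mod n)" using assms by (simp add: cong_def)
  with assms(4) obtain j where j: "b = a + n * j" by (rule cong_le_imp_add_mult)
  have "{x. [x = k] (mod n) \<and> a \<le> x \<and> x < b} = (\<lambda>i. a + n * i) ` {..<j}"
  proof (intro equalityI subsetI)
    fix x assume "x \<in> {x. [x = k] (mod n) \<and> a \<le> x \<and> x < b}"
    then have x: "[x = k] (mod n)" "a \<le> x" "x < b" by auto
    have "[a = x] (mod n)" using x assms by (simp add: cong_def)
    with x(2) obtain i where i: "x = a + n * i" by (rule cong_le_imp_add_mult)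
    then have "i < j" using x(3) j by simp
    then show "x \<in> (\<lambda>i. a + n * i) ` {..<j}" using i by blast
  qed (use assms j in \<open>auto simp: cong_def\<close>)
  moreover have "inj_on (\<lambda>i. a + n * i) {..<j}" using assms(1) by (auto simp: inj_on_def)
  ultimately show ?thesis using j by (simp add: card_image)
qed

section \<open>Generators and Apery set of a numerical semigroup\<close>

lemma add_submonoid_generated: "add_submonoid (generated X)"
  unfolding generated_def by (rule hull_in) (auto simp: add_submonoid_def)

lemma add_submonoid_mult_mem:
  assumes "add_submonoid S" "a \<in> S"
  shows "j * a \<in> S"
  using assms by (induction j) (auto simp: add_submonoid_def)

text \<open>The progression \<open>k + n * j\<close> is infinite, so it cannot lie inside the finite
  complement of \<open>S\<close>.\<close>

lemma numerical_semigroup_class_nonempty: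
  assumes "numerical_semigroup S" "n > 0"
  shows "\<exists>s\<in>S. [s = k] (mod n)"
proof -
  have inf: "infinite (range (\<lambda>j. k + n * j))"
    using assms(2) by (subst finite_image_iff) (auto simp: inj_on_def)
  have "\<not> range (\<lambda>j. k + n * j) \<subseteq> - S"
    using inf assms(1) finite_subset unfolding numerical_semigroup_def by blast
  then obtain j where "k + n * j \<in> S" by blast
  then show ?thesis by (intro bexI[of _ "k + n * j"]) (simp_all add: cong_def)
qed

text \<open>If \<open>s\<close> in \<open>S\<close> is not least in its class, subtracting
  \<open>n\<close> stays in \<open>S\<close>; if it is least, a difference \<open>s - n\<close> in
  \<open>S\<close> would be a smaller element of the same class.\<close>

lemma Ap_eq_class_min:
  assumes "numerical_semigroup S" "n \<in> S" "n > 0"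
  shows "Ap S n = class_min S n ` {0..<n}"
proof -
  have add: "s + n \<in> S" if "s \<in> S" for s
    using assms that by (auto simp: numerical_semigroup_def add_submonoid_def)
  have iff: "x \<in> S \<longleftrightarrow> class_min S n k \<le> x" if "[x = k] (mod n)" for x k
    using add numerical_semigroup_class_nonempty[OF assms(1,3)] that by (rule mem_class_iff)
  have cm: "class_min S n k \<in> S" "[class_min S n k = k] (mod n)" for k
    using class_min_mem[OF numerical_semigroup_class_nonempty[OF assms(1,3)]] by auto
  show ?thesis
  proof (intro equalityI subsetI)
    fix s assume "s \<in> Ap S n"
    then have s: "s \<in> S" "int s - int n \<notin> int ` S" by (auto simp: Ap_def)
    let ?k = "s mod n"
    have le: "class_min S n ?k \<le> s" using iff[of s ?k] s(1) by (simp add: cong_def)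
    moreover have "[class_min S n ?k = s] (mod n)" using cm(2)[of ?k] by (simp add: cong_def)
    ultimately obtain j where j: "s = class_min S n ?k + n * j"
      by (rule cong_le_imp_add_mult)
    have "j = 0"
    proof (rule ccontr)
      assume "j \<noteq> 0"
      then obtain i where "j = Suc i" by (cases j) auto
      then have "int s - int n = int (class_min S n ?k + n * i)"
        using arg_cong[OF j, of int] by (simp add: algebra_simps)
      then show False using s(2) add_mult_mem[OF add cm(1)] by blast
    qed
    then show "s \<in> class_min S n ` {0..<n}" using j assms(3) by auto
  next
    fix s assume "s \<in> class_min S n ` {0..<n}"
    then obtain k where k: "s = class_min S n k" by auto
    have "int s - int n \<notin> int ` S"
    proof
      assume "int s - int n \<in> int ` S"
      then obtain t where t: "t \<in> S" "s = t + n" by (auto simp: diff_eq_eq simp flip: of_nat_add)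
      have "[t = k] (mod n)" using cm(2)[of k] unfolding k[symmetric] t(2) by (simp add: cong_def)
      then have "s \<le> t" using iff t(1) k by blast
      then show False using t(2) assms(3) by simp
    qed
    then show "s \<in> Ap S n" using k cm(1) by (auto simp: Ap_def)
  qed
qed

lemma generated_Apery:
  assumes "numerical_semigroup S" "n \<in> S" "n > 0"
  shows "S = generated ({n} \<union> class_min S n ` {1..<n})" (is "S = ?G")
proof
  have sub: "add_submonoid S" using assms(1) by (simp add: numerical_semigroup_def)
  have cm: "class_min S n k \<in> S" "[class_min S n k = k] (mod n)" for k
    using class_min_mem[OF numerical_semigroup_class_nonempty[OF assms(1,3)]] by auto
  show "?G \<subseteq> S"
    unfolding generated_def using sub assms(2) cm(1) by (intro hull_minimal) auto
  have G: "add_submonoid ?G" by (rule add_submonoid_generated)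
  have gens: "{n} \<union> class_min S n ` {1..<n} \<subseteq> ?G" unfolding generated_def by (rule hull_subset)
  show "S \<subseteq> ?G"
  proof
    fix s assume s: "s \<in> S"
    let ?k = "s mod n"
    have "class_min S n ?k \<le> s" using s by (intro class_min_le) (auto simp: cong_def)
    moreover have "[class_min S n ?k = s] (mod n)" using cm(2)[of ?k] by (simp add: cong_def)
    ultimately obtain j where j: "s = class_min S n ?k + n * j"
      by (rule cong_le_imp_add_mult)
    have "class_min S n ?k \<in> ?G"
    \<comment> \<open>The least element of class 0 is not among the listed generators, but it is 0,
      which every submonoid contains.\<close>
    proof (cases "?k = 0")
      case True
      have "class_min S n 0 \<le> 0"
        using sub by (intro class_min_le) (auto simp: add_submonoid_def)
      then show ?thesis using True G by (simp add: add_submonoid_def)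
    next
      case False
      then show ?thesis using gens assms(3) by auto
    qed
    moreover have "n * j \<in> ?G"
      using add_submonoid_mult_mem[OF G, of n j] gens by (simp add: mult.commute)
    ultimately show "s \<in> ?G" using G j unfolding add_submonoid_def by metis
  qed
qed

section \<open>The size of \<open>S - T\<close> and the least elements of \<open>T\<close>\<close>

lemma n_mult_card_diff:
  fixes S T :: "nat set"
  assumes "n > 0" "T \<subseteq> S"
    and addS: "\<And>s. s \<in> S \<Longrightarrow> s + n \<in> S" and addT: "\<And>s. s \<in> T \<Longrightarrow> s + n \<in> T"
    and ne: "\<And>k. \<exists>s\<in>T. [s = k] (mod n)"
  shows "n * card (S - T) = (\<Sum>k = 0..<n. class_min T n k - class_min S n k)"
proof -
  let ?C = "\<lambda>k. {x. [x = k] (mod n) \<and> class_min S n k \<le> x \<and> x < class_min T n k}"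
  have neS: "\<exists>s\<in>S. [s = k] (mod n)" for k using ne[of k] assms(2) by blast
  have S_iff: "x \<in> S \<longleftrightarrow> class_min S n k \<le> x" if "[x = k] (mod n)" for x k
    using addS neS that by (rule mem_class_iff)
  have T_iff: "x \<in> T \<longleftrightarrow> class_min T n k \<le> x" if "[x = k] (mod n)" for x k
    using addT ne that by (rule mem_class_iff)
  have cS: "[class_min S n k = k] (mod n)" for k
    using neS by (rule class_min_mem)
  have cT: "class_min T n k \<in> T" "[class_min T n k = k] (mod n)" for k
    using class_min_mem[OF ne] by auto
  \<comment> \<open>This makes the truncated differences in the sum exact.\<close>
  have le: "class_min S n k \<le> class_min T n k" for k
    using subsetD[OF assms(2) cT(1)] cT(2) by (rule class_min_le)
  have "S - T = (\<Union>k\<in>{0..<n}. ?C k)"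
  proof (intro equalityI subsetI)
    fix x assume "x \<in> S - T"
    moreover have "[x = x mod n] (mod n)" by (simp add: cong_def)
    ultimately have "x \<in> ?C (x mod n)" using S_iff[of x "x mod n"] T_iff[of x "x mod n"] by auto
    then show "x \<in> (\<Union>k\<in>{0..<n}. ?C k)" using assms(1) by (intro UN_I[of "x mod n"]) simp_all
  next
    fix x assume "x \<in> (\<Union>k\<in>{0..<n}. ?C k)"
    then obtain k where "x \<in> ?C k" by blast
    then show "x \<in> S - T" using S_iff[of x k] T_iff[of x k] by auto
  qed
  moreover have "card (\<Union>k\<in>{0..<n}. ?C k) = (\<Sum>k = 0..<n. card (?C k))"
    by (intro card_UN_disjoint) (auto simp: cong_def)
  ultimately show ?thesis
    using card_residue_interval[OF assms(1) cS cT(2) le] by (simp add: sum_distrib_left)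
qed

text \<open>Adding \<open>class_min S n k\<close> to any member of the set gives an element of
  \<open>T\<close> in class \<open>k\<close>, so no member lies below the claimed value. Decomposing
  the least element of \<open>T\<close> in that class shows that the value is attained.\<close>

lemma Min_eq_class_min_diff:
  fixes r :: "nat \<Rightarrow> nat \<Rightarrow> nat"
  assumes S: "numerical_semigroup S" "n \<in> S" "n > 0"
    and r: "\<And>k i. r k i = nat ((int k - int i * int q) mod int n)"
    and T: "T = {q * a + b | a b. a \<in> S - {0} \<and> b \<in> S}"
  shows "Min ({int q * int n} \<union> {int q * int (class_min S n i) - int (class_min S n k)
            + int (class_min S n (r k i)) | i. i \<in> {1..<n}})
         = int (class_min T n k) - int (class_min S n k)"
    (is "Min ?X = _")
proof (rule Min_eqI)
  let ?w = "class_min S n"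
  have cm: "?w k \<in> S" "[?w k = k] (mod n)" for k
    using class_min_mem[OF numerical_semigroup_class_nonempty[OF S(1,3)]] by auto
  \<comment> \<open>The detour through the integers is due to \<open>k - i * q\<close>, which may be
    negative.\<close>
  have cong_r: "[r k i + i * q = k] (mod n)" for i
  proof -
    have "int (r k i) = (int k - int i * int q) mod int n" using S(3) by (simp add: r)
    then have "[int (r k i) = int k - int i * int q] (mod int n)" by (simp add: cong_def)
    then have "[int (r k i) + int i * int q = int k] (mod int n)"
      by (metis cong_add_rcancel diff_add_cancel)
    then show ?thesis by (metis cong_int_iff of_nat_add of_nat_mult)
  qed
  have t0: "q * n + ?w k \<in> T" "[q * n + ?w k = k] (mod n)"
    using S cm[of k] by (auto simp: T cong_def)
  have ti: "q * ?w i + ?w (r k i) \<in> T" "[q * ?w i + ?w (r k i) = k] (mod n)" if "i \<in> {1..<n}" for i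
  proof -
    \<comment> \<open>Since 0 < \<open>i\<close> < \<open>n\<close>, class \<open>i\<close> does not
      contain 0, so \<open>?w i\<close> is admissible as the nonzero summand.\<close>
    have "?w i \<noteq> 0" using cm(2)[of i] that by (intro notI) (simp add: cong_def)
    then show "q * ?w i + ?w (r k i) \<in> T" using cm(1) by (auto simp: T)
    have "[q * ?w i + ?w (r k i) = q * i + r k i] (mod n)"
      by (intro cong_add cong_mult cong_refl cm)
    then show "[q * ?w i + ?w (r k i) = k] (mod n)"
      using cong_r[of i] by (metis cong_trans add.commute mult.commute)
  qed
  show "finite ?X" by simp
  show "int (class_min T n k) - int (?w k) \<le> y" if "y \<in> ?X" for y
    using that class_min_le[OF t0] class_min_le[OF ti]
    by (fastforce simp flip: of_nat_mult of_nat_add)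
  have mT: "class_min T n k \<in> T" "[class_min T n k = k] (mod n)"
    using class_min_mem[of T k n] t0 by blast+
  then obtain a b where ab: "class_min T n k = q * a + b" "a \<in> S" "a \<noteq> 0" "b \<in> S"
    by (auto simp: T)
  define i where "i = a mod n"
  have a: "[a = i] (mod n)" by (simp add: i_def cong_def)
  have "[q * a + b = q * i + b] (mod n)" using a by (intro cong_add cong_mult cong_refl)
  \<comment> \<open>The class of \<open>a\<close> determines that of \<open>b\<close>: cancelling
    \<open>i * q\<close> leaves the residue \<open>r k i\<close>.\<close>
  then have "[i * q + b = i * q + r k i] (mod n)"
    using mT(2) ab(1) cong_r[of i] by (metis cong_sym cong_trans add.commute mult.commute)
  then have b: "[b = r k i] (mod n)" by (simp add: cong_add_lcancel_nat)
  have wb: "?w (r k i) \<le> b" using ab(4) b by (rule class_min_le)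
  show "int (class_min T n k) - int (?w k) \<in> ?X"
  proof (cases "i = 0")
    case True
    \<comment> \<open>In class 0 the bound \<open>?w 0\<close> = 0 is too weak; a nonzero multiple
      of \<open>n\<close> is at least \<open>n\<close>.\<close>
    then have "n \<le> a" using ab(3) unfolding i_def by (metis mod_less not_le)
    have "[b = k] (mod n)" using b cong_r[of i] True by (metis add_0_right cong_trans mult_0)
    then have "?w k \<le> b" using ab(4) by (intro class_min_le)
    then have "q * n + ?w k \<le> class_min T n k" using \<open>n \<le> a\<close> ab(1) by (simp add: add_mono)
    then have "class_min T n k = q * n + ?w k" using class_min_le[OF t0] by simp
    then show ?thesis by simp
  next
    case False
    then have i: "i \<in> {1..<n}" using S(3) by (simp add: i_def)
    have "?w i \<le> a" using ab(2) a by (rule class_min_le)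
    then have "q * ?w i + ?w (r k i) \<le> class_min T n k" using wb ab(1) by (simp add: add_mono)
    then have "class_min T n k = q * ?w i + ?w (r k i)" using class_min_le[OF ti[OF i]] by simp
    then have "int (class_min T n k) - int (?w k) = int q * int (?w i) - int (?w k) + int (?w (r k i))"
      by simp
    then show ?thesis using i by blast
  qed
qed

theorem theorem3p3:
  fixes q n :: nat and S :: "nat set" and w :: "nat \<Rightarrow> nat" and r :: "nat \<Rightarrow> nat \<Rightarrow> nat"
  assumes "q > 0"
    and "numerical_semigroup S"
    and "n \<in> S - {0}"
    and "\<And>i. i < n \<Longrightarrow> w i = (LEAST s. s \<in> S \<and> [s = i] (mod n))"
    and "\<And>k i. r k i = nat ((int k - int i * int q) mod int n)"
  shows "w 0 = 0 \<and> Ap S n = w ` {0..<n} \<and>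
    S = generated ({n} \<union> w ` {1..<n}) \<and>
    real (GM q S) = 1 + 1 / real n *
           (\<Sum>k = 0..<n. real_of_int
              (Min ({int q * int n} \<union>
                    {int q * int (w i) - int (w k) + int (w (r k i)) | i. i \<in> {1..<n}})))"
proof -
  have S: "numerical_semigroup S" "n \<in> S" "n > 0" using assms(2,3) by auto
  have sub: "add_submonoid S" using S(1) by (simp add: numerical_semigroup_def)
  then have add: "a + b \<in> S" if "a \<in> S" "b \<in> S" for a b
    using that by (simp add: add_submonoid_def)
  have w: "w i = class_min S n i" if "i < n" for i using assms(4)[OF that] by (simp add: class_min_def)
  \<comment> \<open>\<open>w\<close> is specified only below \<open>n\<close>, so this bound is
    needed to rewrite \<open>w (r k i)\<close>.\<close>
  have r: "r k i < n" for k i using S(3) by (simp add: assms(5) nat_less_iff)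
  define T where "T = {q * a + b | a b. a \<in> S - {0} \<and> b \<in> S}"
  have TS: "T \<subseteq> S" unfolding T_def by (auto intro!: add add_submonoid_mult_mem[OF sub])
  have addT: "s + n \<in> T" if s: "s \<in> T" for s
  proof -
    obtain a b where ab: "s = q * a + b" "a \<in> S - {0}" "b \<in> S"
      using s unfolding T_def by blast
    then have "s + n = q * a + (b + n)" "b + n \<in> S" using add[OF _ S(2)] by auto
    then show ?thesis using ab(2) unfolding T_def by blast
  qed
  have ne: "\<exists>s\<in>T. [s = k] (mod n)" for k
  proof -
    obtain s where "s \<in> S" "[s = k] (mod n)"
      using numerical_semigroup_class_nonempty[OF S(1,3)] by (rule bexE)
    \<comment> \<open>Taking \<open>a = n\<close> shifts \<open>s\<close> by a multiple of
      \<open>n\<close>, which leaves its class unchanged.\<close>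
    then have "q * n + s \<in> T" "[q * n + s = k] (mod n)"
      using assms(3) unfolding T_def by (blast, simp add: cong_def)
    then show ?thesis by blast
  qed
  have le: "class_min S n k \<le> class_min T n k" for k
    using subsetD[OF TS class_min_mem(1)[OF ne]] class_min_mem(2)[OF ne] by (rule class_min_le)
  have "class_min S n 0 \<le> 0" using sub by (intro class_min_le) (auto simp: add_submonoid_def)
  then have "w 0 = 0" using w S(3) by simp
  moreover have "w ` {0..<n} = class_min S n ` {0..<n}" "w ` {1..<n} = class_min S n ` {1..<n}"
    using w by (auto intro: image_cong)
  moreover have "Min ({int q * int n} \<union>
        {int q * int (w i) - int (w k) + int (w (r k i)) | i. i \<in> {1..<n}})
      = int (class_min T n k - class_min S n k)" (is "Min ?X = _") if "k < n" for k
  proof -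
    have "?X = {int q * int n} \<union> {int q * int (class_min S n i) - int (class_min S n k)
            + int (class_min S n (r k i)) | i. i \<in> {1..<n}}"
      unfolding Setcompr_eq_image
      by (intro arg_cong2[of _ _ _ _ "(\<union>)"] image_cong refl) (use w r that in auto)
    then show ?thesis
      using Min_eq_class_min_diff[OF S assms(5) T_def] le by (simp add: of_nat_diff)
  qed
  then have "(\<Sum>k = 0..<n. real_of_int (Min ({int q * int n} \<union>
        {int q * int (w i) - int (w k) + int (w (r k i)) | i. i \<in> {1..<n}})))
      = real (n * card (S - T))"
    using n_mult_card_diff[OF S(3) TS add[OF _ S(2)] addT ne] by simp
  ultimately show ?thesis
    using Ap_eq_class_min[OF S] generated_Apery[OF S] S(3)
    unfolding GM_def T_def[symmetric] by simp
qed

end
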